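(* Let $(\mathfrak{A},\mathfrak{A}_0)$ be a quasi *-algebra with unit $\mathsf{e}$ and let $\mathcal{M}$ be a balanced subset of $\mathcal{I}_{\mathfrak{A}_0}(\mathfrak{A})$. The following are equivalent: (i) $\mathcal{M}$ is sufficient; (ii) $\mathcal{K}_{\mathcal{M}}\cap(-\mathcal{K}_{\mathcal{M}})=\{0\}$, where $\mathcal{K}_{\mathcal{M}}=\{a\in\mathfrak{A}:\varphi(ax,x)\ge0\ \ \forall\varphi\in\mathcal{M},\ \forall x\in\mathfrak{A}_0\}$.
   Context: Vector spaces are complex; sesquilinear forms are linear in the first variable. A quasi *-algebra $(\mathfrak{A},\mathfrak{A}_0)$ is a vector space $\mathfrak{A}$ with a *-algebra $\mathfrak{A}_0$ contained in $\mathfrak{A}$ as a subspace, such that: (i) $\mathfrak{A}$ carries an involution $a\mapsto a^*$ extending that of $\mathfrak{A}_0$; (ii) $\mathfrak{A}$ is a bimodule over $\mathfrak{A}_0$, with module multiplications extending the multiplication of $\mathfrak{A}_0$; in particular $(xa)y=x(ay)$ and $a(xy)=(ax)y$ for $a\in\mathfrak{A}$, $x,y\in\mathfrak{A}_0$; (iii) $(ax)^*=x^*a^*$ for $a\in\mathfrak{A}$, $x\in\mathfrak{A}_0$. A unit is an element $\mathsf{e}\in\mathfrak{A}_0$ with $a\mathsf{e}=\mathsf{e}a=a$ for all $a\in\mathfrak{A}$. $\mathcal{Q}_{\mathfrak{A}_0}(\mathfrak{A})$ is the set of sesquilinear forms $\varphi$ on $\mathfrak{A}\times\mathfrak{A}$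 with $\varphi(a,a)\ge0$ for $a\in\mathfrak{A}$ and $\varphi(ax,y)=\varphi(x,a^*y)$ for $a\in\mathfrak{A}$, $x,y\in\mathfrak{A}_0$. For such $\varphi$, $N_\varphi=\{a:\varphi(a,a)=0\}$, $\lambda_\varphi:\mathfrak{A}\to\mathfrak{A}/N_\varphi$ is the quotient map, and $\mathcal{H}_\varphi$ is the Hilbert space completion of $\lambda_\varphi(\mathfrak{A})$ for $\langle\lambda_\varphi(a)|\lambda_\varphi(b)\rangle=\varphi(a,b)$. $\mathcal{I}_{\mathfrak{A}_0}(\mathfrak{A})$ is the set of $\varphi\in\mathcal{Q}_{\mathfrak{A}_0}(\mathfrak{A})$ with $\lambda_\varphi(\mathfrak{A}_0)$ dense in $\mathcal{H}_\varphi$. For $x\in\mathfrak{A}_0$, $\varphi^x(a,b):=\varphi(ax,bx)$. A set $\mathcal{M}\subset\mathcal{I}_{\mathfrak{A}_0}(\mathfrak{A})$ is balanced if $\varphi\in\mathcal{M}$, $x\in\mathfrak{A}_0$ imply $\varphi^x\in\mathcal{M}$; it is sufficient if it is balanced and for every $a\in\mathfrak{A}\setminus\{0\}$ there is $\varphi\in\mathcal{M}$ with $\varphi(a,a)>0$. *)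

theory Defs
  imports "HOL-Analysis.Analysis"
begin

text \<open>
  The vector space is the whole type \<open>'a\<close>. The operation \<open>\<odot>\<close> stands for both module
  multiplications and for the multiplication of \<open>A0\<close>, so that their compatibility is built in;
  only products with at least one factor in \<open>A0\<close> are meaningful, and nothing is assumed about
  the others. Likewise \<open>star\<close> is the involution on the whole space, restricting to that of \<open>A0\<close>.
  That \<open>A0\<close> is itself a *-algebra follows by taking all elements in \<open>A0\<close>.
\<close>

locale quasi_star_algebra = vector_space cscale
  for cscale :: "complex \<Rightarrow> 'a::ab_group_add \<Rightarrow> 'a" (infixr \<open>*\<^sub>s\<close> 75) +
  fixes A0 :: "'a set"
    and mul :: "'a \<Rightarrow> 'a \<Rightarrow> 'a" (infixl \<open>\<odot>\<close> 70)
    and star :: "'a \<Rightarrow> 'a"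
  assumes A0_subspace: "subspace A0"
    and A0_mul: "x \<in> A0 \<Longrightarrow> y \<in> A0 \<Longrightarrow> x \<odot> y \<in> A0"
    and A0_star: "x \<in> A0 \<Longrightarrow> star x \<in> A0"
    and star_star: "star (star a) = a"
    and star_add: "star (a + b) = star a + star b"
    and star_scale: "star (c *\<^sub>s a) = cnj c *\<^sub>s star a"
    and right_add: "x \<in> A0 \<Longrightarrow> (a + b) \<odot> x = a \<odot> x + b \<odot> x"
      "x \<in> A0 \<Longrightarrow> y \<in> A0 \<Longrightarrow> a \<odot> (x + y) = a \<odot> x + a \<odot> y"
    and left_add: "x \<in> A0 \<Longrightarrow> x \<odot> (a + b) = x \<odot> a + x \<odot> b"
      "x \<in> A0 \<Longrightarrow> y \<in> A0 \<Longrightarrow> (x + y) \<odot> a = x \<odot> a + y \<odot> a"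
    and right_scale: "x \<in> A0 \<Longrightarrow> (c *\<^sub>s a) \<odot> x = c *\<^sub>s (a \<odot> x)"
      "x \<in> A0 \<Longrightarrow> a \<odot> (c *\<^sub>s x) = c *\<^sub>s (a \<odot> x)"
    and left_scale: "x \<in> A0 \<Longrightarrow> x \<odot> (c *\<^sub>s a) = c *\<^sub>s (x \<odot> a)"
      "x \<in> A0 \<Longrightarrow> (c *\<^sub>s x) \<odot> a = c *\<^sub>s (x \<odot> a)"
    and right_assoc: "x \<in> A0 \<Longrightarrow> y \<in> A0 \<Longrightarrow> (a \<odot> x) \<odot> y = a \<odot> (x \<odot> y)"
    and left_assoc: "x \<in> A0 \<Longrightarrow> y \<in> A0 \<Longrightarrow> x \<odot> (y \<odot> a) = (x \<odot> y) \<odot> a"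
    and mid_assoc: "x \<in> A0 \<Longrightarrow> y \<in> A0 \<Longrightarrow> (x \<odot> a) \<odot> y = x \<odot> (a \<odot> y)"
    and star_mul: "x \<in> A0 \<Longrightarrow> star (a \<odot> x) = star x \<odot> star a"

definition is_unit_elem :: "'a set \<Rightarrow> ('a \<Rightarrow> 'a \<Rightarrow> 'a) \<Rightarrow> 'a \<Rightarrow> bool" where
  "is_unit_elem A0 mul e \<longleftrightarrow> e \<in> A0 \<and> (\<forall>a. mul a e = a \<and> mul e a = a)"

definition cauchy_seqs :: "'b set \<Rightarrow> ('b \<Rightarrow> 'b \<Rightarrow> real) \<Rightarrow> (nat \<Rightarrow> 'b) set" where
  "cauchy_seqs X d = {s. Metric_space.MCauchy X d s}"

definition cauchy_rel :: "'b set \<Rightarrow> ('b \<Rightarrow> 'b \<Rightarrow> real) \<Rightarrow> ((nat \<Rightarrow> 'b) \<times> (nat \<Rightarrow> 'b)) set" where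
  "cauchy_rel X d = {(s, t). s \<in> cauchy_seqs X d \<and> t \<in> cauchy_seqs X d \<and>
     (\<lambda>n. d (s n) (t n)) \<longlonglongrightarrow> 0}"

definition completion_space :: "'b set \<Rightarrow> ('b \<Rightarrow> 'b \<Rightarrow> real) \<Rightarrow> (nat \<Rightarrow> 'b) set set" where
  "completion_space X d = cauchy_seqs X d // cauchy_rel X d"

text \<open>The value 0 outside the completion only serves the global nonnegativity and symmetry
  demanded by \<^locale>\<open>Metric_space\<close>.\<close>

definition completion_dist ::
    "'b set \<Rightarrow> ('b \<Rightarrow> 'b \<Rightarrow> real) \<Rightarrow> (nat \<Rightarrow> 'b) set \<Rightarrow> (nat \<Rightarrow> 'b) set \<Rightarrow> real" where
  "completion_dist X d S T =
     (if S \<in> completion_space X d \<and> T \<in> completion_space X d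
      then lim (\<lambda>n. d ((SOME s. s \<in> S) n) ((SOME t. t \<in> T) n)) else 0)"

definition completion_embed :: "'b set \<Rightarrow> ('b \<Rightarrow> 'b \<Rightarrow> real) \<Rightarrow> 'b \<Rightarrow> (nat \<Rightarrow> 'b) set" where
  "completion_embed X d p = cauchy_rel X d `` {\<lambda>_. p}"

definition sesquilinear_form ::
    "(complex \<Rightarrow> 'a::ab_group_add \<Rightarrow> 'a) \<Rightarrow> ('a \<Rightarrow> 'a \<Rightarrow> complex) \<Rightarrow> bool" where
  "sesquilinear_form cscale \<phi> \<longleftrightarrow>
     (\<forall>a b c. \<phi> (a + b) c = \<phi> a c + \<phi> b c) \<and>
     (\<forall>a b c. \<phi> a (b + c) = \<phi> a b + \<phi> a c) \<and>
     (\<forall>k a b. \<phi> (cscale k a) b = k * \<phi> a b) \<and>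
     (\<forall>k a b. \<phi> a (cscale k b) = cnj k * \<phi> a b)"

text \<open>Here \<open>\<le>\<close> is the order on the complex numbers for which \<open>0 \<le> z\<close> means that \<open>z\<close> is real
  and nonnegative.\<close>

definition Q_forms ::
    "(complex \<Rightarrow> 'a::ab_group_add \<Rightarrow> 'a) \<Rightarrow> 'a set \<Rightarrow> ('a \<Rightarrow> 'a \<Rightarrow> 'a) \<Rightarrow> ('a \<Rightarrow> 'a)
      \<Rightarrow> ('a \<Rightarrow> 'a \<Rightarrow> complex) set" where
  "Q_forms cscale A0 mul star = {\<phi>. sesquilinear_form cscale \<phi> \<and> (\<forall>a. 0 \<le> \<phi> a a) \<and>
     (\<forall>a. \<forall>x\<in>A0. \<forall>y\<in>A0. \<phi> (mul a x) y = \<phi> x (mul (star a) y))}"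

definition null_space :: "('a \<Rightarrow> 'a \<Rightarrow> complex) \<Rightarrow> 'a set" where
  "null_space \<phi> = {a. \<phi> a a = 0}"

definition quot_map :: "('a::ab_group_add \<Rightarrow> 'a \<Rightarrow> complex) \<Rightarrow> 'a \<Rightarrow> 'a set" where
  "quot_map \<phi> a = (\<lambda>n. a + n) ` null_space \<phi>"

definition quot_space :: "('a::ab_group_add \<Rightarrow> 'a \<Rightarrow> complex) \<Rightarrow> 'a set set" where
  "quot_space \<phi> = range (quot_map \<phi>)"

text \<open>For a positive form, the value does not depend on the chosen representatives, by the
  Cauchy-Schwarz inequality.\<close>

definition quot_inner :: "('a \<Rightarrow> 'a \<Rightarrow> complex) \<Rightarrow> 'a set \<Rightarrow> 'a set \<Rightarrow> complex" where
  "quot_inner \<phi> S T = \<phi> (SOME a. a \<in> S) (SOME b. b \<in> T)"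

text \<open>The norm distance \<open>\<parallel>S - T\<parallel>\<close>, where \<open>S - T\<close> is the coset of a difference of
  representatives.\<close>

definition quot_dist :: "('a::ab_group_add \<Rightarrow> 'a \<Rightarrow> complex) \<Rightarrow> 'a set \<Rightarrow> 'a set \<Rightarrow> real" where
  "quot_dist \<phi> S T =
     (let D = quot_map \<phi> ((SOME a. a \<in> S) - (SOME b. b \<in> T)) in sqrt (Re (quot_inner \<phi> D D)))"

text \<open>
  The Hilbert space completion of the quotient, with its norm distance and the canonical map
  from \<open>'a\<close>. As a metric space it is the metric completion of the quotient; the extended vector
  space operations and inner product are not needed to speak of dense subsets.
\<close>

definition H_space :: "('a::ab_group_add \<Rightarrow> 'a \<Rightarrow> complex) \<Rightarrow> (nat \<Rightarrow> 'a set) set set" where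
  "H_space \<phi> = completion_space (quot_space \<phi>) (quot_dist \<phi>)"

definition H_dist ::
    "('a::ab_group_add \<Rightarrow> 'a \<Rightarrow> complex) \<Rightarrow> (nat \<Rightarrow> 'a set) set \<Rightarrow> (nat \<Rightarrow> 'a set) set \<Rightarrow> real" where
  "H_dist \<phi> = completion_dist (quot_space \<phi>) (quot_dist \<phi>)"

definition H_map :: "('a::ab_group_add \<Rightarrow> 'a \<Rightarrow> complex) \<Rightarrow> 'a \<Rightarrow> (nat \<Rightarrow> 'a set) set" where
  "H_map \<phi> a = completion_embed (quot_space \<phi>) (quot_dist \<phi>) (quot_map \<phi> a)"

definition I_forms ::
    "(complex \<Rightarrow> 'a::ab_group_add \<Rightarrow> 'a) \<Rightarrow> 'a set \<Rightarrow> ('a \<Rightarrow> 'a \<Rightarrow> 'a) \<Rightarrow> ('a \<Rightarrow> 'a)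
      \<Rightarrow> ('a \<Rightarrow> 'a \<Rightarrow> complex) set" where
  "I_forms cscale A0 mul star = {\<phi> \<in> Q_forms cscale A0 mul star.
     Metric_space.mtopology (H_space \<phi>) (H_dist \<phi>) closure_of (H_map \<phi> ` A0) = H_space \<phi>}"

definition form_conj ::
    "('a \<Rightarrow> 'a \<Rightarrow> 'a) \<Rightarrow> ('a \<Rightarrow> 'a \<Rightarrow> complex) \<Rightarrow> 'a \<Rightarrow> 'a \<Rightarrow> 'a \<Rightarrow> complex" where
  "form_conj mul \<phi> x = (\<lambda>a b. \<phi> (mul a x) (mul b x))"

definition balanced ::
    "'a set \<Rightarrow> ('a \<Rightarrow> 'a \<Rightarrow> 'a) \<Rightarrow> ('a \<Rightarrow> 'a \<Rightarrow> complex) set \<Rightarrow> bool" where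
  "balanced A0 mul \<M> \<longleftrightarrow> (\<forall>\<phi>\<in>\<M>. \<forall>x\<in>A0. form_conj mul \<phi> x \<in> \<M>)"

definition sufficient ::
    "'a::zero set \<Rightarrow> ('a \<Rightarrow> 'a \<Rightarrow> 'a) \<Rightarrow> ('a \<Rightarrow> 'a \<Rightarrow> complex) set \<Rightarrow> bool" where
  "sufficient A0 mul \<M> \<longleftrightarrow> balanced A0 mul \<M> \<and> (\<forall>a. a \<noteq> 0 \<longrightarrow> (\<exists>\<phi>\<in>\<M>. 0 < \<phi> a a))"

definition K_cone ::
    "'a set \<Rightarrow> ('a \<Rightarrow> 'a \<Rightarrow> 'a) \<Rightarrow> ('a \<Rightarrow> 'a \<Rightarrow> complex) set \<Rightarrow> 'a set" where
  "K_cone A0 mul \<M> = {a. \<forall>\<phi>\<in>\<M>. \<forall>x\<in>A0. 0 \<le> \<phi> (mul a x) x}"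

end

theory Submission
  imports Defs
begin

text \<open>
  Put \<open>\<Delta> = \<K> \<inter> (-\<K>)\<close>. Since \<open>\<le>\<close> on the complex numbers is antisymmetric, \<open>a \<in> \<Delta>\<close> means
  \<open>\<phi>(ax,x) = 0\<close> for all \<open>\<phi> \<in> \<M>\<close> and \<open>x \<in> A0\<close>. The theorem holds because this quadratic
  condition already forces \<open>\<phi>(a,a) = 0\<close> for all \<open>\<phi> \<in> \<M>\<close>, and conversely.

  If \<open>\<phi>(ax,x)\<close> vanishes on \<open>A0\<close>, polarization gives \<open>\<phi>(ax,y) = 0\<close> for all \<open>x, y \<in> A0\<close>. With
  \<open>x\<close> the unit, \<open>a\<close> is orthogonal to \<open>A0\<close> with respect to \<open>\<phi>\<close>; as the image of \<open>A0\<close> is dense in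
  the Hilbert space of \<open>\<phi>\<close>, the Cauchy-Schwarz inequality yields \<open>\<phi>(a,a) = 0\<close>. A sufficient
  family then leaves only \<open>a = 0\<close>.

  Conversely, suppose \<open>\<phi>(a,a) = 0\<close> for all \<open>\<phi> \<in> \<M>\<close>. As \<open>\<M>\<close> is balanced, also
  \<open>\<phi>(ax,ax) = 0\<close>, and Cauchy-Schwarz gives \<open>\<phi>(ax,x) = 0\<close>. Hence \<open>a \<in> \<Delta>\<close>, and \<open>\<Delta> = {0}\<close>
  forces \<open>a = 0\<close>.

  The bulk of the text translates density in the completion into a statement about \<open>\<phi>\<close> itself:
  every \<open>b\<close> has elements \<open>x \<in> A0\<close> with \<open>\<phi>(b - x, b - x)\<close> arbitrarily small
  (\<open>seminorm_approx\<close>). The closure in the metric topology has its usual description by balls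
  only once the quotient by the null space and the completion built from Cauchy sequences are
  known to be metric spaces.
\<close>

section \<open>The completion of a metric space by Cauchy sequences\<close>

context Metric_space
begin

lemma cauchy_seqs_in_space: "s \<in> cauchy_seqs M d \<Longrightarrow> s n \<in> M"
  by (auto simp: cauchy_seqs_def MCauchy_def)

lemma const_in_cauchy_seqs: "p \<in> M \<Longrightarrow> (\<lambda>_. p) \<in> cauchy_seqs M d"
  by (auto simp: cauchy_seqs_def MCauchy_def)

lemma abs_dist_diff_le:
  assumes "a \<in> M" "b \<in> M" "a' \<in> M" "b' \<in> M"
  shows "\<bar>d a b - d a' b'\<bar> \<le> d a a' + d b b'"
proof -
  have "d a b \<le> d a a' + d a' b' + d b b'"
    using triangle[of a a' b] triangle[of a' b' b] assms commute[of b b'] by linarith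
  moreover have "d a' b' \<le> d a a' + d a b + d b b'"
    using triangle[of a' a b'] triangle[of a b b'] assms commute[of a a'] by linarith
  ultimately show ?thesis by linarith
qed

lemma convergent_dist_cauchy_seqs:
  assumes "s \<in> cauchy_seqs M d" "t \<in> cauchy_seqs M d"
  shows "convergent (\<lambda>n. d (s n) (t n))"
proof -
  have "Cauchy (\<lambda>n. d (s n) (t n))"
  proof (rule metric_CauchyI)
    fix e :: real assume "0 < e"
    then have e2: "0 < e / 2" by simp
    obtain N1 where N1: "\<And>m n. N1 \<le> m \<Longrightarrow> N1 \<le> n \<Longrightarrow> d (s m) (s n) < e / 2"
      using assms(1) e2 unfolding cauchy_seqs_def MCauchy_def mem_Collect_eq by meson
    obtain N2 where N2: "\<And>m n. N2 \<le> m \<Longrightarrow> N2 \<le> n \<Longrightarrow> d (t m) (t n) < e / 2"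
      using assms(2) e2 unfolding cauchy_seqs_def MCauchy_def mem_Collect_eq by meson
    have "dist (d (s m) (t m)) (d (s n) (t n)) < e" if "max N1 N2 \<le> m" "max N1 N2 \<le> n" for m n
      using abs_dist_diff_le[of "s m" "t m" "s n" "t n"] N1[of m n] N2[of m n] that
        cauchy_seqs_in_space[OF assms(1)] cauchy_seqs_in_space[OF assms(2)]
      by (simp add: dist_real_def)
    then show "\<exists>N. \<forall>m\<ge>N. \<forall>n\<ge>N. dist (d (s m) (t m)) (d (s n) (t n)) < e" by blast
  qed
  then show ?thesis by (simp add: real_Cauchy_convergent)
qed

lemma cauchy_rel_trans:
  assumes "(s, t) \<in> cauchy_rel M d" "(t, u) \<in> cauchy_rel M d"
  shows "(s, u) \<in> cauchy_rel M d"
proof -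
  have seqs: "s \<in> cauchy_seqs M d" "t \<in> cauchy_seqs M d" "u \<in> cauchy_seqs M d"
    and lims: "(\<lambda>n. d (s n) (t n)) \<longlonglongrightarrow> 0" "(\<lambda>n. d (t n) (u n)) \<longlonglongrightarrow> 0"
    using assms by (auto simp: cauchy_rel_def)
  have "(\<lambda>n. d (s n) (u n)) \<longlonglongrightarrow> 0"
  proof (rule tendsto_sandwich[OF _ _ tendsto_const])
    show "(\<lambda>n. d (s n) (t n) + d (t n) (u n)) \<longlonglongrightarrow> 0"
      using tendsto_add[OF lims] by simp
    show "\<forall>\<^sub>F n in sequentially. d (s n) (u n) \<le> d (s n) (t n) + d (t n) (u n)"
      using seqs by (intro always_eventually) (auto intro: triangle cauchy_seqs_in_space)
  qed simp
  then show ?thesis using seqs by (auto simp: cauchy_rel_def)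
qed

lemma equiv_cauchy_rel: "equiv (cauchy_seqs M d) (cauchy_rel M d)"
proof (rule equivI)
  show "cauchy_rel M d \<subseteq> cauchy_seqs M d \<times> cauchy_seqs M d"
    by (auto simp: cauchy_rel_def)
  show "refl_on (cauchy_seqs M d) (cauchy_rel M d)"
    by (auto simp: refl_on_def cauchy_rel_def cauchy_seqs_in_space)
  show "sym (cauchy_rel M d)"
    by (auto simp: sym_def cauchy_rel_def commute)
  show "trans (cauchy_rel M d)"
    by (meson transI cauchy_rel_trans)
qed

lemma completion_dist_tendsto:
  assumes "s \<in> cauchy_seqs M d" "t \<in> cauchy_seqs M d"
  shows "(\<lambda>n. d (s n) (t n)) \<longlonglongrightarrow>
    completion_dist M d (cauchy_rel M d `` {s}) (cauchy_rel M d `` {t})"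
proof -
  let ?S = "cauchy_rel M d `` {s}" and ?T = "cauchy_rel M d `` {t}"
  define s' where "s' = (SOME s. s \<in> ?S)"
  define t' where "t' = (SOME t. t \<in> ?T)"
  have self: "s \<in> ?S" "t \<in> ?T"
    using equiv_class_self[OF equiv_cauchy_rel] assms by auto
  have "s' \<in> ?S"
    unfolding s'_def using self(1) by (rule someI[of "\<lambda>u. u \<in> ?S"])
  moreover have "t' \<in> ?T"
    unfolding t'_def using self(2) by (rule someI[of "\<lambda>u. u \<in> ?T"])
  ultimately have seqs: "s' \<in> cauchy_seqs M d" "t' \<in> cauchy_seqs M d"
    and lims: "(\<lambda>n. d (s n) (s' n)) \<longlonglongrightarrow> 0" "(\<lambda>n. d (t n) (t' n)) \<longlonglongrightarrow> 0"
    by (auto simp: cauchy_rel_def)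
  have "(\<lambda>n. d (s n) (t n) - d (s' n) (t' n)) \<longlonglongrightarrow> 0"
  proof (rule tendsto_0_le)
    show "(\<lambda>n. d (s n) (s' n) + d (t n) (t' n)) \<longlonglongrightarrow> 0"
      using tendsto_add[OF lims] by simp
    show "\<forall>\<^sub>F n in sequentially. norm (d (s n) (t n) - d (s' n) (t' n))
        \<le> norm (d (s n) (s' n) + d (t n) (t' n)) * 1"
      using assms seqs
      by (intro always_eventually)
        (auto intro!: abs_dist_diff_le cauchy_seqs_in_space)
  qed
  moreover have "(\<lambda>n. d (s' n) (t' n)) \<longlonglongrightarrow> completion_dist M d ?S ?T"
  proof -
    have "?S \<in> completion_space M d" "?T \<in> completion_space M d"
      using assms by (auto simp: completion_space_def quotientI)
    then have "completion_dist M d ?S ?T = lim (\<lambda>n. d (s' n) (t' n))"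
      by (simp add: completion_dist_def s'_def t'_def)
    then show ?thesis
      using convergent_dist_cauchy_seqs[OF seqs] by (simp add: convergent_LIMSEQ_iff)
  qed
  ultimately show ?thesis
    using tendsto_add by fastforce
qed

lemma completion_space_cases:
  assumes "S \<in> completion_space M d"
  obtains s where "s \<in> cauchy_seqs M d" "S = cauchy_rel M d `` {s}"
  using assms by (auto simp: completion_space_def elim: quotientE)

lemma completion_dist_nonneg: "0 \<le> completion_dist M d S T"
proof (cases "S \<in> completion_space M d \<and> T \<in> completion_space M d")
  case True
  then obtain s t where st: "s \<in> cauchy_seqs M d" "t \<in> cauchy_seqs M d"
    "S = cauchy_rel M d `` {s}" "T = cauchy_rel M d `` {t}"
    by (metis completion_space_cases)
  show ?thesis
    using LIMSEQ_le_const[OF completion_dist_tendsto[OF st(1,2)]] st by auto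
qed (auto simp: completion_dist_def)

theorem Metric_space_completion:
  "Metric_space (completion_space M d) (completion_dist M d)"
proof
  fix S T
  show "0 \<le> completion_dist M d S T" by (rule completion_dist_nonneg)
  show "completion_dist M d S T = completion_dist M d T S"
    by (simp add: completion_dist_def commute)
next
  fix S T assume "S \<in> completion_space M d" "T \<in> completion_space M d"
  then obtain s t where st: "s \<in> cauchy_seqs M d" "t \<in> cauchy_seqs M d"
    "S = cauchy_rel M d `` {s}" "T = cauchy_rel M d `` {t}"
    by (metis completion_space_cases)
  have lim: "(\<lambda>n. d (s n) (t n)) \<longlonglongrightarrow> completion_dist M d S T"
    using completion_dist_tendsto[OF st(1,2)] st by simp
  have "S = T \<longleftrightarrow> (s, t) \<in> cauchy_rel M d"
    using eq_equiv_class_iff[OF equiv_cauchy_rel st(1,2)] st by simp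
  also have "\<dots> \<longleftrightarrow> (\<lambda>n. d (s n) (t n)) \<longlonglongrightarrow> 0"
    using st by (simp add: cauchy_rel_def)
  also have "\<dots> \<longleftrightarrow> completion_dist M d S T = 0"
    using lim LIMSEQ_unique by fastforce
  finally show "completion_dist M d S T = 0 \<longleftrightarrow> S = T" by simp
next
  fix S T U
  assume "S \<in> completion_space M d" "T \<in> completion_space M d" "U \<in> completion_space M d"
  then obtain s t u where seqs: "s \<in> cauchy_seqs M d" "t \<in> cauchy_seqs M d" "u \<in> cauchy_seqs M d"
    and cls: "S = cauchy_rel M d `` {s}" "T = cauchy_rel M d `` {t}" "U = cauchy_rel M d `` {u}"
    by (metis completion_space_cases)
  show "completion_dist M d S U \<le> completion_dist M d S T + completion_dist M d T U"
    unfolding cls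
  proof (rule LIMSEQ_le[OF completion_dist_tendsto tendsto_add[OF completion_dist_tendsto completion_dist_tendsto]])
    show "\<exists>N. \<forall>n\<ge>N. d (s n) (u n) \<le> d (s n) (t n) + d (t n) (u n)"
      using seqs by (auto intro: triangle cauchy_seqs_in_space)
  qed (use seqs in auto)
qed

lemma completion_dist_embed:
  assumes "p \<in> M" "q \<in> M"
  shows "completion_dist M d (completion_embed M d p) (completion_embed M d q) = d p q"
  using completion_dist_tendsto[OF const_in_cauchy_seqs const_in_cauchy_seqs, OF assms]
  unfolding completion_embed_def by (simp add: LIMSEQ_const_iff)

lemma completion_embed_in_space: "p \<in> M \<Longrightarrow> completion_embed M d p \<in> completion_space M d"
  by (simp add: completion_embed_def completion_space_def const_in_cauchy_seqs quotientI)

text \<open>The canonical map is isometric, so a subset with dense image in the completion is already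
  dense in the original space.\<close>

lemma dense_if_dense_in_completion:
  assumes dense: "Metric_space.mtopology (completion_space M d) (completion_dist M d) closure_of
      (completion_embed M d ` S) = completion_space M d"
    and "S \<subseteq> M" "p \<in> M" "0 < r"
  shows "\<exists>q\<in>S. d p q < r"
proof -
  interpret C: Metric_space "completion_space M d" "completion_dist M d"
    by (rule Metric_space_completion)
  have "completion_embed M d p \<in> C.mtopology closure_of (completion_embed M d ` S)"
    using dense completion_embed_in_space[OF \<open>p \<in> M\<close>] by simp
  then obtain q where "q \<in> S" "completion_embed M d q \<in> C.mball (completion_embed M d p) r"
    using \<open>0 < r\<close> by (auto simp: C.metric_closure_of)
  then show ?thesis
    using assms completion_dist_embed by (metis C.in_mball subsetD)
qed

end

section \<open>Positive sesquilinear forms\<close>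

locale positive_form =
  fixes cscale :: "complex \<Rightarrow> 'a::ab_group_add \<Rightarrow> 'a"
    and \<phi> :: "'a \<Rightarrow> 'a \<Rightarrow> complex"
  assumes sesquilinear: "sesquilinear_form cscale \<phi>"
    and nonneg: "0 \<le> \<phi> a a"
begin

lemma add_left: "\<phi> (a + b) c = \<phi> a c + \<phi> b c"
  and add_right: "\<phi> a (b + c) = \<phi> a b + \<phi> a c"
  and scale_left: "\<phi> (cscale k a) b = k * \<phi> a b"
  and scale_right: "\<phi> a (cscale k b) = cnj k * \<phi> a b"
  using sesquilinear unfolding sesquilinear_form_def by blast+

lemma zero_left: "\<phi> 0 b = 0"
  using add_left[of 0 0 b] by simp

lemma zero_right: "\<phi> b 0 = 0"
  using add_right[of b 0 0] by simp

lemma minus_left: "\<phi> (- a) b = - \<phi> a b"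
  using add_left[of a "- a" b] by (simp add: zero_left add_eq_0_iff)

lemma minus_right: "\<phi> a (- b) = - \<phi> a b"
  using add_right[of a b "- b"] by (simp add: zero_right add_eq_0_iff)

lemma diff_left: "\<phi> (a - b) c = \<phi> a c - \<phi> b c"
  using add_left[of a "- b" c] by (simp add: minus_left)

lemma diff_right: "\<phi> a (b - c) = \<phi> a b - \<phi> a c"
  using add_right[of a b "- c"] by (simp add: minus_right)

lemma Re_nonneg: "0 \<le> Re (\<phi> a a)" and Im_zero: "Im (\<phi> a a) = 0"
  using nonneg[of a] by (auto simp: less_eq_complex_def)

text \<open>Over the complex numbers positivity alone forces Hermitian symmetry: \<open>\<phi>\<close> is real at
  \<open>a + b\<close> and at \<open>a + \<i>b\<close>, which fixes the imaginary and the real part of \<open>\<phi>(b,a)\<close>.\<close>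

lemma hermitian: "\<phi> b a = cnj (\<phi> a b)"
proof -
  have "Im (\<phi> a b) + Im (\<phi> b a) = 0"
    using Im_zero[of "a + b"] by (simp add: add_left add_right Im_zero)
  moreover have "Re (\<phi> b a) - Re (\<phi> a b) = 0"
    using Im_zero[of "a + cscale \<i> b"]
    by (simp add: add_left add_right Im_zero scale_left scale_right)
  ultimately show ?thesis by (simp add: complex_eq_iff)
qed

text \<open>The proof reads off nonnegativity at \<open>a - t\<phi>(a,b)b\<close> for real \<open>t\<close>; the factor
  \<open>\<phi>(a,b)\<close> rotates the cross term to a real number. For \<open>\<phi>(b,b) = 0\<close> a large \<open>t\<close> shows that
  \<open>\<phi>(a,b)\<close> vanishes.\<close>

lemma Cauchy_Schwarz: "(cmod (\<phi> a b))\<^sup>2 \<le> Re (\<phi> a a) * Re (\<phi> b b)"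
proof (cases "\<phi> a b = 0")
  case True
  then show ?thesis by (simp add: Re_nonneg)
next
  case False
  define A where "A = Re (\<phi> a a)"
  define B where "B = Re (\<phi> b b)"
  define m where "m = (cmod (\<phi> a b))\<^sup>2"
  have m: "0 < m" using False by (simp add: m_def)
  have mz: "\<phi> a b * cnj (\<phi> a b) = of_real m"
    unfolding m_def by (rule complex_norm_square[symmetric])
  have key: "0 \<le> A - 2 * t * m + t\<^sup>2 * m * B" for t
  proof -
    let ?c = "of_real t * \<phi> a b"
    have "\<phi> (a - cscale ?c b) (a - cscale ?c b)
        = \<phi> a a - cnj ?c * \<phi> a b - ?c * cnj (\<phi> a b) + ?c * cnj ?c * \<phi> b b"
      by (simp add: diff_left diff_right scale_left scale_right hermitian[of b a] algebra_simps)
    also have "\<dots> = \<phi> a a - 2 * of_real t * (\<phi> a b * cnj (\<phi> a b))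
        + (of_real t)\<^sup>2 * (\<phi> a b * cnj (\<phi> a b)) * \<phi> b b"
      by (simp add: algebra_simps power2_eq_square)
    also have "\<dots> = \<phi> a a - of_real (2 * t * m) + of_real (t\<^sup>2 * m) * \<phi> b b"
      unfolding mz by simp
    finally have "Re (\<phi> (a - cscale ?c b) (a - cscale ?c b)) = A - 2 * t * m + t\<^sup>2 * m * B"
      by (simp add: A_def B_def del: of_real_mult of_real_power)
    then show ?thesis using Re_nonneg by metis
  qed
  have "B \<noteq> 0"
  proof
    assume "B = 0"
    with key[of "(A + 1) / (2 * m)"] m show False by simp
  qed
  then have B: "0 < B" using Re_nonneg[of b] by (simp add: B_def)
  have "0 \<le> A - m / B"
    using key[of "1 / B"] B by (simp add: power2_eq_square)
  then have "m \<le> A * B" using B by (simp add: field_simps)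
  then show ?thesis by (simp add: A_def B_def m_def)
qed

definition seminorm :: "'a \<Rightarrow> real" where
  "seminorm a = sqrt (Re (\<phi> a a))"

lemma cmod_form_le: "cmod (\<phi> a b) \<le> seminorm a * seminorm b"
  using Cauchy_Schwarz[of a b]
  by (simp add: seminorm_def real_le_rsqrt flip: real_sqrt_mult)

lemma seminorm_nonneg: "0 \<le> seminorm a"
  by (simp add: seminorm_def Re_nonneg)

lemma seminorm_square: "(seminorm a)\<^sup>2 = Re (\<phi> a a)"
  by (simp add: seminorm_def Re_nonneg)

lemma seminorm_triangle: "seminorm (a + b) \<le> seminorm a + seminorm b"
proof (rule power2_le_imp_le)
  have "Re (\<phi> (a + b) (a + b)) = Re (\<phi> a a) + Re (\<phi> b b) + 2 * Re (\<phi> a b)"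
    using hermitian[of b a] by (simp add: add_left add_right)
  moreover have "Re (\<phi> a b) \<le> seminorm a * seminorm b"
    using cmod_form_le complex_Re_le_cmod order_trans by blast
  ultimately show "(seminorm (a + b))\<^sup>2 \<le> (seminorm a + seminorm b)\<^sup>2"
    by (simp add: seminorm_square power2_sum)
qed (simp add: seminorm_nonneg)

lemma seminorm_minus_commute: "seminorm (a - b) = seminorm (b - a)"
  by (simp add: seminorm_def diff_left diff_right algebra_simps)

lemma seminorm_eq_0_iff: "seminorm a = 0 \<longleftrightarrow> a \<in> null_space \<phi>"
  by (simp add: seminorm_def null_space_def complex_eq_iff Im_zero)

lemma null_left: "a \<in> null_space \<phi> \<Longrightarrow> \<phi> a b = 0"
  using cmod_form_le[of a b] by (simp flip: seminorm_eq_0_iff)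

section \<open>The quotient by the null space\<close>

lemma mem_quot_map_iff: "b \<in> quot_map \<phi> a \<longleftrightarrow> b - a \<in> null_space \<phi>"
  unfolding quot_map_def by (auto simp: image_iff algebra_simps intro!: bexI[of _ "b - a"])

lemma some_in_quot_map: "(SOME b. b \<in> quot_map \<phi> a) - a \<in> null_space \<phi>"
proof -
  have "a \<in> quot_map \<phi> a"
    by (simp add: mem_quot_map_iff null_space_def zero_left)
  then show ?thesis
    by (metis someI mem_quot_map_iff)
qed

lemma seminorm_diff_null:
  assumes "a - b \<in> null_space \<phi>"
  shows "seminorm a = seminorm b"
  using seminorm_triangle[of "a - b" b] seminorm_triangle[of "b - a" a] assms
    seminorm_minus_commute[of a b]
  by (simp flip: seminorm_eq_0_iff)

lemma quot_dist_eq_seminorm_some: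
  "quot_dist \<phi> S T = seminorm ((SOME a. a \<in> S) - (SOME b. b \<in> T))"
  unfolding quot_dist_def quot_inner_def Let_def seminorm_def[symmetric]
  by (rule seminorm_diff_null[OF some_in_quot_map])

lemma quot_dist_eq_seminorm: "quot_dist \<phi> (quot_map \<phi> a) (quot_map \<phi> b) = seminorm (a - b)"
proof -
  define a' where "a' = (SOME c. c \<in> quot_map \<phi> a)"
  define b' where "b' = (SOME c. c \<in> quot_map \<phi> b)"
  have "a' - a \<in> null_space \<phi>" "b' - b \<in> null_space \<phi>"
    unfolding a'_def b'_def by (rule some_in_quot_map)+
  then have "(a' - b') - (a - b) \<in> null_space \<phi>"
    using seminorm_triangle[of "a' - a" "b - b'"] seminorm_minus_commute[of b b']
      seminorm_nonneg[of "(a' - b') - (a - b)"]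
    by (simp add: algebra_simps flip: seminorm_eq_0_iff)
  then show ?thesis
    unfolding quot_dist_eq_seminorm_some a'_def[symmetric] b'_def[symmetric]
    by (rule seminorm_diff_null)
qed

lemma quot_map_eq_iff: "quot_map \<phi> a = quot_map \<phi> b \<longleftrightarrow> seminorm (a - b) = 0"
proof
  assume "quot_map \<phi> a = quot_map \<phi> b"
  then have "seminorm (a - b) = seminorm (b - b)"
    by (metis quot_dist_eq_seminorm)
  then show "seminorm (a - b) = 0"
    by (simp add: seminorm_def zero_left)
next
  assume 0: "seminorm (a - b) = 0"
  have "seminorm (c - a) = 0 \<longleftrightarrow> seminorm (c - b) = 0" for c
    using 0 seminorm_triangle[of "c - a" "a - b"] seminorm_triangle[of "c - b" "b - a"]
      seminorm_minus_commute[of a b] seminorm_nonneg[of "c - a"] seminorm_nonneg[of "c - b"]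
    by auto
  then show "quot_map \<phi> a = quot_map \<phi> b"
    by (auto simp: mem_quot_map_iff simp flip: seminorm_eq_0_iff)
qed

lemma Metric_space_quot: "Metric_space (quot_space \<phi>) (quot_dist \<phi>)"
proof
  fix S T
  show "0 \<le> quot_dist \<phi> S T"
    by (simp add: quot_dist_eq_seminorm_some seminorm_nonneg)
  show "quot_dist \<phi> S T = quot_dist \<phi> T S"
    by (simp add: quot_dist_eq_seminorm_some seminorm_minus_commute)
next
  fix S T assume "S \<in> quot_space \<phi>" "T \<in> quot_space \<phi>"
  then obtain a b where "S = quot_map \<phi> a" "T = quot_map \<phi> b"
    by (auto simp: quot_space_def)
  then show "quot_dist \<phi> S T = 0 \<longleftrightarrow> S = T"
    by (simp add: quot_dist_eq_seminorm quot_map_eq_iff)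
next
  fix S T U assume "S \<in> quot_space \<phi>" "T \<in> quot_space \<phi>" "U \<in> quot_space \<phi>"
  then obtain a b c where "S = quot_map \<phi> a" "T = quot_map \<phi> b" "U = quot_map \<phi> c"
    by (auto simp: quot_space_def)
  then show "quot_dist \<phi> S U \<le> quot_dist \<phi> S T + quot_dist \<phi> T U"
    using seminorm_triangle[of "a - b" "b - c"] by (simp add: quot_dist_eq_seminorm)
qed

text \<open>The canonical map to the Hilbert space factors through the quotient and then the completion,
  and both steps preserve distances.\<close>

lemma seminorm_approx:
  assumes "Metric_space.mtopology (H_space \<phi>) (H_dist \<phi>) closure_of (H_map \<phi> ` X) = H_space \<phi>"
    and "0 < r"
  shows "\<exists>x\<in>X. seminorm (b - x) < r"
proof -
  interpret Q: Metric_space "quot_space \<phi>" "quot_dist \<phi>" by (rule Metric_space_quot)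
  have "H_map \<phi> ` X = completion_embed (quot_space \<phi>) (quot_dist \<phi>) ` quot_map \<phi> ` X"
    by (simp add: H_map_def image_image)
  then have "\<exists>q\<in>quot_map \<phi> ` X. quot_dist \<phi> (quot_map \<phi> b) q < r"
    using assms Q.dense_if_dense_in_completion[of "quot_map \<phi> ` X" "quot_map \<phi> b" r]
    by (auto simp: H_space_def H_dist_def quot_space_def)
  then show ?thesis by (auto simp: quot_dist_eq_seminorm)
qed

text \<open>In \<open>\<phi>(a,a) = \<phi>(a, a - x)\<close>, valid for every \<open>x \<in> X\<close>, the right-hand side can be made
  arbitrarily small by density.\<close>

lemma orthogonal_to_dense_imp_null:
  assumes dense: "Metric_space.mtopology (H_space \<phi>) (H_dist \<phi>) closure_of (H_map \<phi> ` X) = H_space \<phi>"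
    and orth: "\<And>x. x \<in> X \<Longrightarrow> \<phi> a x = 0"
  shows "\<phi> a a = 0"
proof (rule ccontr)
  assume "\<phi> a a \<noteq> 0"
  then have pos: "0 < seminorm a"
    using seminorm_eq_0_iff[of a] seminorm_nonneg[of a] by (auto simp: null_space_def)
  obtain x where x: "x \<in> X" "seminorm (a - x) < seminorm a"
    using seminorm_approx[OF dense pos] by blast
  have "(seminorm a)\<^sup>2 \<le> cmod (\<phi> a (a - x))"
    using orth[OF x(1)] by (simp add: seminorm_square diff_right complex_Re_le_cmod)
  also have "\<dots> \<le> seminorm a * seminorm (a - x)" by (rule cmod_form_le)
  also have "\<dots> < (seminorm a)\<^sup>2" using x(2) pos by (simp add: power2_eq_square)
  finally show False by simp
qed

end

section \<open>Sufficient families and the cone\<close>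

lemma positive_form_I_forms:
  "\<phi> \<in> I_forms cscale A0 mul star \<Longrightarrow> positive_form cscale \<phi>"
  by (auto simp: I_forms_def Q_forms_def positive_form_def)

context quasi_star_algebra
begin

lemma mul_left_minus: "x \<in> A0 \<Longrightarrow> (- a) \<odot> x = - (a \<odot> x)"
  using right_add(1)[of x a "- a"] right_add(1)[of x 0 0] by (simp add: add_eq_0_iff)

text \<open>Membership in both cones is a quadratic condition, by antisymmetry of the order.\<close>

lemma mem_K_cone_inter_minus_iff:
  assumes "\<M> \<subseteq> I_forms cscale A0 mul star"
  shows "a \<in> K_cone A0 mul \<M> \<inter> uminus ` K_cone A0 mul \<M> \<longleftrightarrow>
    (\<forall>\<phi>\<in>\<M>. \<forall>x\<in>A0. \<phi> (a \<odot> x) x = 0)"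
proof -
  have "\<phi> ((- a) \<odot> x) x = - \<phi> (a \<odot> x) x" if "\<phi> \<in> \<M>" "x \<in> A0" for \<phi> x
  proof -
    interpret positive_form cscale \<phi>
      using assms that positive_form_I_forms by blast
    show ?thesis using that by (simp add: mul_left_minus minus_left)
  qed
  moreover have "a \<in> uminus ` K_cone A0 mul \<M> \<longleftrightarrow> - a \<in> K_cone A0 mul \<M>"
    by (metis image_eqI imageE minus_minus)
  moreover have "0 \<le> z \<and> 0 \<le> - z \<longleftrightarrow> z = 0" for z :: complex
    by (auto simp: less_eq_complex_def complex_eq_iff)
  ultimately show ?thesis
    unfolding K_cone_def by fastforce
qed

text \<open>Polarization: the values at \<open>x + y\<close> and \<open>x + \<i>y\<close> make \<open>\<phi>(ax,y)\<close> and \<open>\<phi>(ay,x)\<close>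
  opposite and equal, respectively.\<close>

lemma polarization:
  assumes "sesquilinear_form cscale \<phi>"
    and diag: "\<And>x. x \<in> A0 \<Longrightarrow> \<phi> (a \<odot> x) x = 0"
    and xy: "x \<in> A0" "y \<in> A0"
  shows "\<phi> (a \<odot> x) y = 0"
proof -
  have sesq: "\<And>a b c. \<phi> (a + b) c = \<phi> a c + \<phi> b c" "\<And>a b c. \<phi> a (b + c) = \<phi> a b + \<phi> a c"
    "\<And>k a b. \<phi> (cscale k a) b = k * \<phi> a b" "\<And>k a b. \<phi> a (cscale k b) = cnj k * \<phi> a b"
    using assms(1) unfolding sesquilinear_form_def by blast+
  have iy: "\<i> *\<^sub>s y \<in> A0" using A0_subspace xy by (simp add: subspace_scale)
  have "\<phi> (a \<odot> x) y + \<phi> (a \<odot> y) x = 0"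
    using diag[of "x + y"] A0_subspace xy
    by (simp add: subspace_add right_add sesq diag add.commute)
  moreover have "\<i> * \<phi> (a \<odot> y) x - \<i> * \<phi> (a \<odot> x) y = 0"
    using diag[of "x + \<i> *\<^sub>s y"] diag[OF iy] A0_subspace xy iy
    by (simp add: subspace_add right_add right_scale sesq diag)
  then have "\<phi> (a \<odot> y) x = \<phi> (a \<odot> x) y" by simp
  ultimately show ?thesis by simp
qed

lemma sufficient_imp_trivial:
  assumes unit: "is_unit_elem A0 mul e"
    and \<M>: "\<M> \<subseteq> I_forms cscale A0 mul star"
    and suff: "sufficient A0 mul \<M>"
    and a: "\<And>\<phi> x. \<phi> \<in> \<M> \<Longrightarrow> x \<in> A0 \<Longrightarrow> \<phi> (a \<odot> x) x = 0"
  shows "a = 0"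
proof (rule ccontr)
  assume "a \<noteq> 0"
  then obtain \<phi> where \<phi>: "\<phi> \<in> \<M>" "0 < \<phi> a a"
    using suff unfolding sufficient_def by blast
  interpret positive_form cscale \<phi>
    using \<phi> \<M> positive_form_I_forms by blast
  have "\<phi> a y = 0" if "y \<in> A0" for y
    using polarization[OF sesquilinear a[OF \<phi>(1)], of e y] that unit
    by (simp add: is_unit_elem_def)
  moreover have
    "Metric_space.mtopology (H_space \<phi>) (H_dist \<phi>) closure_of (H_map \<phi> ` A0) = H_space \<phi>"
    using \<phi> \<M> by (auto simp: I_forms_def)
  ultimately have "\<phi> a a = 0" by (intro orthogonal_to_dense_imp_null)
  then show False using \<phi> by simp
qed

lemma balanced_null_imp_orthogonal:
  assumes \<M>: "\<M> \<subseteq> I_forms cscale A0 mul star"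
    and bal: "balanced A0 mul \<M>"
    and null: "\<And>\<phi>. \<phi> \<in> \<M> \<Longrightarrow> \<phi> a a = 0"
    and "\<phi> \<in> \<M>" "x \<in> A0"
  shows "\<phi> (a \<odot> x) x = 0"
proof -
  interpret positive_form cscale \<phi>
    using assms positive_form_I_forms by blast
  have "form_conj mul \<phi> x \<in> \<M>"
    using bal assms by (auto simp: balanced_def)
  from null[OF this] have "a \<odot> x \<in> null_space \<phi>"
    by (simp add: form_conj_def null_space_def)
  then show ?thesis by (rule null_left)
qed

end

theorem proposition3p6:
  fixes cscale :: "complex \<Rightarrow> 'a::ab_group_add \<Rightarrow> 'a"
    and A0 :: "'a set"
    and mul :: "'a \<Rightarrow> 'a \<Rightarrow> 'a"
    and star :: "'a \<Rightarrow> 'a"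
    and e :: 'a
    and \<M> :: "('a \<Rightarrow> 'a \<Rightarrow> complex) set"
  assumes "quasi_star_algebra cscale A0 mul star"
    and "is_unit_elem A0 mul e"
    and "\<M> \<subseteq> I_forms cscale A0 mul star"
    and "balanced A0 mul \<M>"
  shows "sufficient A0 mul \<M> \<longleftrightarrow>
    K_cone A0 mul \<M> \<inter> uminus ` K_cone A0 mul \<M> = {0}"
proof -
  interpret quasi_star_algebra cscale A0 mul star by fact
  note mem = mem_K_cone_inter_minus_iff[OF assms(3)]
  have positive: "positive_form cscale \<phi>" if "\<phi> \<in> \<M>" for \<phi>
    using assms(3) that positive_form_I_forms by blast
  show ?thesis
  proof
    assume suff: "sufficient A0 mul \<M>"
    have "\<phi> (mul 0 x) x = 0" if "\<phi> \<in> \<M>" "x \<in> A0" for \<phi> x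
      using balanced_null_imp_orthogonal[OF assms(3,4) _ that] positive
      by (metis positive_form.zero_left)
    then have "0 \<in> K_cone A0 mul \<M> \<inter> uminus ` K_cone A0 mul \<M>"
      unfolding mem by blast
    moreover have "a = 0" if "a \<in> K_cone A0 mul \<M> \<inter> uminus ` K_cone A0 mul \<M>" for a
      using sufficient_imp_trivial[OF assms(2,3) suff] that unfolding mem by blast
    ultimately show "K_cone A0 mul \<M> \<inter> uminus ` K_cone A0 mul \<M> = {0}" by blast
  next
    assume trivial: "K_cone A0 mul \<M> \<inter> uminus ` K_cone A0 mul \<M> = {0}"
    have "\<exists>\<phi>\<in>\<M>. 0 < \<phi> a a" if "a \<noteq> 0" for a
    proof (rule ccontr)
      assume "\<not> (\<exists>\<phi>\<in>\<M>. 0 < \<phi> a a)"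
      then have "\<phi> a a = 0" if "\<phi> \<in> \<M>" for \<phi>
        using positive_form.nonneg[OF positive[OF that], of a] that
        by (metis order_le_less)
      then have "a \<in> K_cone A0 mul \<M> \<inter> uminus ` K_cone A0 mul \<M>"
        unfolding mem using balanced_null_imp_orthogonal[OF assms(3,4)] by blast
      with trivial that show False by blast
    qed
    then show "sufficient A0 mul \<M>"
      using assms(4) by (simp add: sufficient_def)
  qed
qed

end
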